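(* Let $G:[0,\infty)\times S^{n-1}\to[0,\infty)$ be continuous. If $K_i\in\mathcal{K}_o^n$, $i\in\mathbb{N}$, and $K_i\to K\in\mathcal{K}_o^n$ as $i\to\infty$, then $$\lim_{i\to\infty}\widetilde{V}_G(K_i)=\widetilde{V}_G(K).$$
   Context: Let $n\ge2$, let $o$ be the origin of $\mathbb{R}^n$ and $S^{n-1}$ the unit sphere; $du$ denotes integration with respect to $(n-1)$-dimensional Hausdorff measure. $\mathcal{K}_o^n$ is the class of compact convex subsets of $\mathbb{R}^n$ containing $o$ (not necessarily in the interior). For $K\in\mathcal{K}_o^n$ and $u\in S^{n-1}$, $\rho_K(u)=\max\{\lambda\ge0:\lambda u\in K\}$ is the radial function. Convergence of sets is with respect to the Hausdorff metric $\delta(K,L)=\sup_{u\in S^{n-1}}|h_K(u)-h_L(u)|$, where $h_K(u)=\max\{\langle u,x\rangle:x\in K\}$. The general dual volume of $K\in\mathcal{K}_o^n$ is $$\widetilde{V}_G(K)=\int_{S^{n-1}}G(\rho_K(u),u)\,du.$$ *)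

theory Defs
  imports "HOL-Analysis.Analysis"
begin

section \<open>Hausdorff measure\<close>

text \<open>The factor \<open>unit_ball_vol d / 2 ^ d\<close> is the normalisation under which the
  \<open>d\<close>-dimensional Hausdorff measure on \<open>d\<close>-dimensional Euclidean space is Lebesgue measure.
  The empty set gets weight 0 also for \<open>d = 0\<close>, where \<open>0 ^ 0 = 1\<close>.\<close>

definition hausdorff_weight :: "nat \<Rightarrow> 'a::metric_space set \<Rightarrow> ennreal" where
  "hausdorff_weight d U =
     (if U = {} then 0 else ennreal (unit_ball_vol (real d) * (diameter U / 2) ^ d))"

text \<open>Boundedness is required explicitly because \<^const>\<open>diameter\<close> is unspecified on
  unbounded sets.\<close>

definition hausdorff_pre :: "nat \<Rightarrow> real \<Rightarrow> 'a::metric_space set \<Rightarrow> ennreal" where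
  "hausdorff_pre d \<delta> A =
     (INF U \<in> {U :: nat \<Rightarrow> 'a set. A \<subseteq> (\<Union>i. U i) \<and> (\<forall>i. bounded (U i) \<and> diameter (U i) \<le> \<delta>)}.
        \<Sum>i. hausdorff_weight d (U i))"

definition hausdorff_outer :: "nat \<Rightarrow> 'a::metric_space set \<Rightarrow> ennreal" where
  "hausdorff_outer d A = (SUP \<delta> \<in> {0<..}. hausdorff_pre d \<delta> A)"

definition hausdorff_measure :: "nat \<Rightarrow> 'a::metric_space measure" where
  "hausdorff_measure d = measure_of UNIV (sets borel) (hausdorff_outer d)"

text \<open>\<^const>\<open>measure_of\<close> is the zero measure unless its argument is countably additive on the
  given \<open>\<sigma>\<close>-algebra. The rest of this section shows that \<^const>\<open>hausdorff_outer\<close> is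
  (it is a metric outer measure), so that \<^const>\<open>hausdorff_measure\<close> agrees with it on all
  Borel sets.\<close>

lemma hausdorff_weight_empty [simp]: "hausdorff_weight d {} = 0"
  by (simp add: hausdorff_weight_def)

lemma hausdorff_pre_le:
  assumes "A \<subseteq> (\<Union>i. U i)" "\<And>i. bounded (U i)" "\<And>i. diameter (U i) \<le> \<delta>"
  shows "hausdorff_pre d \<delta> A \<le> (\<Sum>i. hausdorff_weight d (U i))"
  unfolding hausdorff_pre_def using assms by (intro INF_lower) auto

lemma hausdorff_pre_antimono:
  "\<delta> \<le> \<delta>' \<Longrightarrow> hausdorff_pre d \<delta>' A \<le> hausdorff_pre d \<delta> A"
  unfolding hausdorff_pre_def by (intro INF_superset_mono) (auto intro: order_trans)

lemma hausdorff_pre_mono: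
  "A \<subseteq> B \<Longrightarrow> hausdorff_pre d \<delta> A \<le> hausdorff_pre d \<delta> B"
  unfolding hausdorff_pre_def by (intro INF_superset_mono) auto

lemma hausdorff_pre_le_outer:
  "\<delta> > 0 \<Longrightarrow> hausdorff_pre d \<delta> A \<le> hausdorff_outer d A"
  unfolding hausdorff_outer_def by (intro SUP_upper) auto

lemma hausdorff_outer_mono:
  "A \<subseteq> B \<Longrightarrow> hausdorff_outer d A \<le> hausdorff_outer d B"
  unfolding hausdorff_outer_def by (intro SUP_mono) (auto intro: hausdorff_pre_mono)

lemma hausdorff_outer_empty [simp]: "hausdorff_outer d {} = 0"
proof -
  have "hausdorff_pre d \<delta> ({} :: 'a set) = 0" if "\<delta> > 0" for \<delta>
    using hausdorff_pre_le[of "{}" "\<lambda>_. {} :: 'a set" \<delta> d] that by simp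
  then show ?thesis
    unfolding hausdorff_outer_def by (simp add: SUP_constant bot_ennreal)
qed

lemma hausdorff_pre_countably_subadditive:
  fixes A :: "nat \<Rightarrow> 'a::metric_space set"
  shows "hausdorff_pre d \<delta> (\<Union>n. A n) \<le> (\<Sum>n. hausdorff_pre d \<delta> (A n))"
proof (rule ennreal_le_epsilon)
  fix e :: real
  assume fin: "(\<Sum>n. hausdorff_pre d \<delta> (A n)) < top" and e: "0 < e"
  have "\<exists>U :: nat \<Rightarrow> 'a set. A n \<subseteq> (\<Union>i. U i) \<and> (\<forall>i. bounded (U i) \<and> diameter (U i) \<le> \<delta>) \<and>
          (\<Sum>i. hausdorff_weight d (U i)) \<le> hausdorff_pre d \<delta> (A n) + ennreal (e * (1/2) ^ Suc n)" for n
  proof -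
    have "hausdorff_pre d \<delta> (A n) < top"
      using fin by (metis ennreal_suminf_lessD top.not_eq_extremum)
    then have "hausdorff_pre d \<delta> (A n) < hausdorff_pre d \<delta> (A n) + ennreal (e * (1/2) ^ Suc n)"
      using e ennreal_add_left_cancel_less[of "hausdorff_pre d \<delta> (A n)" 0] by (simp add: less_top)
    then show ?thesis
      unfolding hausdorff_pre_def
      by (subst (asm) INF_less_iff) (auto intro: less_imp_le)
  qed
  then obtain U :: "nat \<Rightarrow> nat \<Rightarrow> 'a set" where U:
    "\<And>n. A n \<subseteq> (\<Union>i. U n i)" "\<And>n i. bounded (U n i)" "\<And>n i. diameter (U n i) \<le> \<delta>"
    "\<And>n. (\<Sum>i. hausdorff_weight d (U n i)) \<le> hausdorff_pre d \<delta> (A n) + ennreal (e * (1/2) ^ Suc n)"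
    by metis
  define V where "V k = (case prod_decode k of (n, i) \<Rightarrow> U n i)" for k
  have "(\<Union>n. A n) \<subseteq> (\<Union>k. V k)"
  proof
    fix x assume "x \<in> (\<Union>n. A n)"
    then obtain n i where "x \<in> U n i" using U(1) by blast
    then have "x \<in> V (prod_encode (n, i))" by (simp add: V_def)
    then show "x \<in> (\<Union>k. V k)" by blast
  qed
  then have "hausdorff_pre d \<delta> (\<Union>n. A n) \<le> (\<Sum>k. hausdorff_weight d (V k))"
    by (intro hausdorff_pre_le) (auto simp: V_def U split: prod.split)
  also have "\<dots> = (\<Sum>n. \<Sum>i. hausdorff_weight d (U n i))"
    using suminf_ennreal_2dimen[where f = "\<lambda>(n, i). hausdorff_weight d (U n i)", OF refl]
    by (simp add: V_def case_prod_beta)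
  also have "\<dots> \<le> (\<Sum>n. hausdorff_pre d \<delta> (A n) + ennreal (e * (1/2) ^ Suc n))"
    by (intro suminf_le U) auto
  also have "\<dots> = (\<Sum>n. hausdorff_pre d \<delta> (A n)) + (\<Sum>n. ennreal (e * (1/2) ^ Suc n))"
    by (rule suminf_add[symmetric]) auto
  also have "(\<Sum>n. ennreal (e * (1/2) ^ Suc n)) = ennreal e"
    using sums_mult[OF power_half_series, of e] e by (intro suminf_ennreal_eq) auto
  finally show "hausdorff_pre d \<delta> (\<Union>n. A n) \<le> (\<Sum>n. hausdorff_pre d \<delta> (A n)) + ennreal e" .
qed

lemma hausdorff_outer_countably_subadditive:
  "hausdorff_outer d (\<Union>n. A n) \<le> (\<Sum>n. hausdorff_outer d (A n))"
  unfolding hausdorff_outer_def[of d "\<Union>n. A n"]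
proof (rule SUP_least)
  fix \<delta> :: real assume "\<delta> \<in> {0<..}"
  then have "(\<Sum>n. hausdorff_pre d \<delta> (A n)) \<le> (\<Sum>n. hausdorff_outer d (A n))"
    by (intro suminf_le hausdorff_pre_le_outer) auto
  then show "hausdorff_pre d \<delta> (\<Union>n. A n) \<le> (\<Sum>n. hausdorff_outer d (A n))"
    using hausdorff_pre_countably_subadditive order_trans by blast
qed

lemma outer_measure_space_hausdorff_outer: "outer_measure_space (Pow UNIV) (hausdorff_outer d)"
  by (auto simp: outer_measure_space_def positive_def increasing_def countably_subadditive_def
      intro: hausdorff_outer_mono hausdorff_outer_countably_subadditive)

lemma hausdorff_outer_Un_le:
  "hausdorff_outer d (A \<union> B) \<le> hausdorff_outer d A + hausdorff_outer d B"
proof -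
  have "A \<union> B = (\<Union>n. binaryset A B n)"
    by (simp add: UN_binaryset_eq)
  moreover have "(\<Sum>n. hausdorff_outer d (binaryset A B n)) = hausdorff_outer d A + hausdorff_outer d B"
    by (rule suminf_binaryset_eq) simp
  ultimately show ?thesis
    by (metis hausdorff_outer_countably_subadditive)
qed

lemma hausdorff_pre_separated:
  fixes A B :: "'a::metric_space set"
  assumes sep: "\<And>x y. x \<in> A \<Longrightarrow> y \<in> B \<Longrightarrow> \<delta> < dist x y"
  shows "hausdorff_pre d \<delta> A + hausdorff_pre d \<delta> B \<le> hausdorff_pre d \<delta> (A \<union> B)"
  unfolding hausdorff_pre_def[of d \<delta> "A \<union> B"]
proof (rule INF_greatest, clarsimp)
  fix U :: "nat \<Rightarrow> 'a set"
  assume cov: "A \<subseteq> (\<Union>i. U i)" "B \<subseteq> (\<Union>i. U i)"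
    and U: "\<forall>i. bounded (U i) \<and> diameter (U i) \<le> \<delta>"
  define V where "V i = (if U i \<inter> A = {} then {} else U i)" for i
  define W where "W i = (if U i \<inter> A = {} then U i else {})" for i
  have sub: "V i = {} \<or> V i = U i" "W i = {} \<or> W i = U i" for i by (auto simp: V_def W_def)
  have W0: "\<delta> \<ge> 0" using U diameter_ge_0 order_trans by blast
  have VW: "bounded (V i)" "bounded (W i)" "diameter (V i) \<le> \<delta>" "diameter (W i) \<le> \<delta>" for i
    using U W0 by (auto simp: V_def W_def)
  have "A \<subseteq> (\<Union>i. V i)"
    using cov(1) by (force simp: V_def)
  moreover have "B \<subseteq> (\<Union>i. W i)"
  proof
    fix y assume y: "y \<in> B"
    then obtain i where i: "y \<in> U i" using cov by blast
    have "U i \<inter> A = {}"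
    proof (rule ccontr)
      assume "U i \<inter> A \<noteq> {}"
      then obtain x where "x \<in> U i" "x \<in> A" by blast
      then show False
        using sep[of x y] y i U diameter_bounded_bound[of "U i" x y]
        by (meson leD order_trans)
    qed
    then show "y \<in> (\<Union>i. W i)" using i by (auto simp: W_def)
  qed
  ultimately have "hausdorff_pre d \<delta> A + hausdorff_pre d \<delta> B
      \<le> (\<Sum>i. hausdorff_weight d (V i)) + (\<Sum>i. hausdorff_weight d (W i))"
    using VW by (intro add_mono hausdorff_pre_le)
  also have "\<dots> = (\<Sum>i. hausdorff_weight d (V i) + hausdorff_weight d (W i))"
    by (rule suminf_add) auto
  also have "\<dots> = (\<Sum>i. hausdorff_weight d (U i))"
    by (intro suminf_cong) (simp add: V_def W_def)
  finally show "hausdorff_pre d \<delta> A + hausdorff_pre d \<delta> B \<le> (\<Sum>i. hausdorff_weight d (U i))" .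
qed

lemma hausdorff_outer_eq_SUP:
  "hausdorff_outer d A = (SUP n. hausdorff_pre d (e / real (Suc n)) A)" if "e > 0"
proof (rule antisym)
  show "hausdorff_outer d A \<le> (SUP n. hausdorff_pre d (e / real (Suc n)) A)"
    unfolding hausdorff_outer_def
  proof (rule SUP_least)
    fix \<delta> :: real assume "\<delta> \<in> {0<..}"
    then have "\<delta> / e > 0" using that by simp
    then obtain n where "inverse (real (Suc n)) < \<delta> / e" using reals_Archimedean by blast
    then have "e / real (Suc n) \<le> \<delta>"
      using that by (simp add: field_simps)
    then show "hausdorff_pre d \<delta> A \<le> (SUP n. hausdorff_pre d (e / real (Suc n)) A)"
      by (intro SUP_upper2[of n] hausdorff_pre_antimono) auto
  qed
next
  show "(SUP n. hausdorff_pre d (e / real (Suc n)) A) \<le> hausdorff_outer d A"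
    using that by (intro SUP_least hausdorff_pre_le_outer) simp
qed

lemma hausdorff_outer_separated:
  assumes e: "e > 0" and sep: "\<And>x y. x \<in> A \<Longrightarrow> y \<in> B \<Longrightarrow> e < dist x y"
  shows "hausdorff_outer d A + hausdorff_outer d B \<le> hausdorff_outer d (A \<union> B)"
proof -
  have inc: "incseq (\<lambda>n. hausdorff_pre d (e / real (Suc n)) C)" for C :: "'a set"
    using e by (intro incseq_SucI hausdorff_pre_antimono) (simp add: field_simps)
  have "hausdorff_outer d A + hausdorff_outer d B =
      (SUP n. hausdorff_pre d (e / real (Suc n)) A + hausdorff_pre d (e / real (Suc n)) B)"
    unfolding hausdorff_outer_eq_SUP[OF e] by (intro ennreal_SUP_add[symmetric] inc)
  also have "\<dots> \<le> (SUP n. hausdorff_pre d (e / real (Suc n)) (A \<union> B))"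
  proof (intro SUP_mono' hausdorff_pre_separated)
    fix n x y assume "x \<in> A" "y \<in> B"
    then have "e < dist x y" by (rule sep)
    moreover have "e / real (Suc n) \<le> e" using e by (simp add: field_simps)
    ultimately show "e / real (Suc n) < dist x y" by simp
  qed
  also have "\<dots> = hausdorff_outer d (A \<union> B)"
    by (rule hausdorff_outer_eq_SUP[OF e, symmetric])
  finally show ?thesis .
qed

lemma hausdorff_outer_rings:
  fixes C A :: "'a::metric_space set" and p :: nat
  defines "R \<equiv> \<lambda>k. {x \<in> A. 1 / real (k + 2) \<le> infdist x C \<and> infdist x C < 1 / real (k + 1)}"
  shows "(\<Sum>j<n. hausdorff_outer d (R (2 * j + p))) \<le> hausdorff_outer d (\<Union>j<n. R (2 * j + p))"
proof (induction n)
  case 0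
  then show ?case by simp
next
  case (Suc n)
  define m where "m = 2 * n + p"
  define e where "e = (1 / real m - 1 / real (m + 1)) / 2"
  show ?case
  proof (cases "n = 0")
    case False
    then have m: "m > 0" by (simp add: m_def)
    then have e: "e > 0" by (simp add: e_def frac_less2)
    have sep: "e < dist x y" if x: "x \<in> (\<Union>j<n. R (2 * j + p))" and y: "y \<in> R m" for x y
    proof -
      obtain j where j: "j < n" "x \<in> R (2 * j + p)" using x by blast
      then have "2 * j + p + 2 \<le> m" by (simp add: m_def)
      then have "1 / real m \<le> 1 / real (2 * j + p + 2)"
        using m by (intro divide_left_mono) auto
      also have "\<dots> \<le> infdist x C" using j by (simp add: R_def)
      finally have "1 / real m \<le> infdist x C" .
      moreover have "infdist y C < 1 / real (m + 1)" using y by (simp add: R_def)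
      moreover have "infdist x C \<le> infdist y C + dist x y" by (rule infdist_triangle)
      ultimately have "2 * e < dist x y" by (simp add: e_def)
      then show ?thesis using e by simp
    qed
    have "(\<Sum>j<Suc n. hausdorff_outer d (R (2 * j + p)))
        \<le> hausdorff_outer d (\<Union>j<n. R (2 * j + p)) + hausdorff_outer d (R m)"
      using Suc.IH by (simp add: m_def add_right_mono)
    also have "\<dots> \<le> hausdorff_outer d ((\<Union>j<n. R (2 * j + p)) \<union> R m)"
      by (rule hausdorff_outer_separated[OF e sep])
    also have "(\<Union>j<n. R (2 * j + p)) \<union> R m = (\<Union>j<Suc n. R (2 * j + p))"
      by (auto simp: lessThan_Suc m_def)
    finally show ?thesis .
  qed (simp add: lessThan_Suc)
qed

lemma closed_in_lambda_system_hausdorff_outer: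
  fixes C :: "'a::metric_space set"
  assumes C: "closed C"
  shows "C \<in> lambda_system UNIV (Pow UNIV) (hausdorff_outer d)"
proof -
  have le: "hausdorff_outer d (A \<inter> C) + hausdorff_outer d (A - C) \<le> hausdorff_outer d A"
    if "C \<noteq> {}" and fin: "hausdorff_outer d A < top" for A
  proof -
    define R where "R = (\<lambda>k. {x \<in> A. 1 / real (k + 2) \<le> infdist x C \<and> infdist x C < 1 / real (k + 1)})"
    define B where "B n = {x \<in> A. 1 / real (n + 1) \<le> infdist x C}" for n
    define r where "r k = enn2real (hausdorff_outer d (R k))" for k
    have sub_fin: "hausdorff_outer d D < top" if "D \<subseteq> A" for D
      using hausdorff_outer_mono[OF that, of d] fin by (rule le_less_trans)
    have r: "hausdorff_outer d (R k) = ennreal (r k)" "0 \<le> r k" for k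
      using sub_fin[of "R k"] by (auto simp: r_def R_def)
    have half: "summable (\<lambda>j. r (2 * j + p))" for p
    proof (rule summableI_nonneg_bounded)
      fix n
      have "ennreal (\<Sum>j<n. r (2 * j + p)) = (\<Sum>j<n. hausdorff_outer d (R (2 * j + p)))"
        using r by (simp add: sum_ennreal)
      also have "\<dots> \<le> hausdorff_outer d (\<Union>j<n. R (2 * j + p))"
        unfolding R_def by (rule hausdorff_outer_rings)
      also have "\<dots> \<le> hausdorff_outer d A"
        by (rule hausdorff_outer_mono) (auto simp: R_def)
      finally have "ennreal (\<Sum>j<n. r (2 * j + p)) \<le> hausdorff_outer d A" .
      then show "(\<Sum>j<n. r (2 * j + p)) \<le> enn2real (hausdorff_outer d A)"
        using fin r(2) by (metis enn2real_ennreal enn2real_mono sum_nonneg)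
    qed (simp add: r)
    have "summable r"
    proof (rule summableI_nonneg_bounded)
      fix n
      have "(\<Sum>k<n. r k) \<le> (\<Sum>k<2 * n. r k)"
        using r by (intro sum_mono2) auto
      also have "\<dots> = (\<Sum>j<n. r (2 * j + 0)) + (\<Sum>j<n. r (2 * j + 1))"
        by (induction n) auto
      also have "\<dots> \<le> (\<Sum>j. r (2 * j + 0)) + (\<Sum>j. r (2 * j + 1))"
        using r by (intro add_mono sum_le_suminf half) auto
      finally show "(\<Sum>k<n. r k) \<le> (\<Sum>j. r (2 * j + 0)) + (\<Sum>j. r (2 * j + 1))" .
    qed (simp add: r)
    show ?thesis
    proof (rule ennreal_le_epsilon)
      fix e :: real assume "0 < e"
      then obtain n where n: "norm (\<Sum>k. r (k + n)) < e"
        using suminf_exist_split[OF \<open>0 < e\<close> \<open>summable r\<close>] by blast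
      have cover: "A - C \<subseteq> B n \<union> (\<Union>k. R (k + n))"
      proof
        fix x assume x: "x \<in> A - C"
        then have pos: "infdist x C > 0"
          using C \<open>C \<noteq> {}\<close> by (simp add: infdist_pos_not_in_closed)
        show "x \<in> B n \<union> (\<Union>k. R (k + n))"
        proof (cases "1 / real (n + 1) \<le> infdist x C")
          case True
          then show ?thesis using x by (simp add: B_def)
        next
          case False
          obtain m0 where "inverse (real (Suc m0)) < infdist x C"
            using reals_Archimedean[OF pos] by blast
          then have ex: "\<exists>m. 1 / real (m + 1) \<le> infdist x C"
            by (intro exI[of _ m0]) (simp add: field_simps)
          define m where "m = (LEAST m. 1 / real (m + 1) \<le> infdist x C)"
          have m: "1 / real (m + 1) \<le> infdist x C" unfolding m_def by (rule LeastI_ex[OF ex])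
          have "m > n"
          proof (rule ccontr)
            assume "\<not> m > n"
            then have "1 / real (n + 1) \<le> 1 / real (m + 1)" by (intro divide_left_mono) auto
            then show False using m False by simp
          qed
          then obtain k where k: "m = Suc (k + n)"
            by (metis add.commute less_iff_Suc_add)
          have "\<not> 1 / real (k + n + 1) \<le> infdist x C"
            using not_less_Least[of "k + n" "\<lambda>m. 1 / real (m + 1) \<le> infdist x C"] k m_def by simp
          then have "x \<in> R (k + n)"
            using x m k by (simp add: R_def algebra_simps)
          then show ?thesis by blast
        qed
      qed
      have "hausdorff_outer d (A - C) \<le> hausdorff_outer d (B n \<union> (\<Union>k. R (k + n)))"
        by (rule hausdorff_outer_mono[OF cover])
      also have "\<dots> \<le> hausdorff_outer d (B n) + hausdorff_outer d (\<Union>k. R (k + n))"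
        by (rule hausdorff_outer_Un_le)
      also have "\<dots> \<le> hausdorff_outer d (B n) + (\<Sum>k. hausdorff_outer d (R (k + n)))"
        by (intro add_left_mono hausdorff_outer_countably_subadditive)
      also have "(\<Sum>k. hausdorff_outer d (R (k + n))) = ennreal (\<Sum>k. r (k + n))"
        using r \<open>summable r\<close> by (simp add: suminf_ennreal2)
      also have "\<dots> \<le> ennreal e"
        using n by (intro ennreal_leI) simp
      finally have AC: "hausdorff_outer d (A - C) \<le> hausdorff_outer d (B n) + ennreal e"
        by (simp add: add_left_mono)
      have "hausdorff_outer d (A \<inter> C) + hausdorff_outer d (B n) \<le> hausdorff_outer d (A \<inter> C \<union> B n)"
      proof (rule hausdorff_outer_separated)
        show "0 < 1 / real (n + 1) / 2" by simp
        fix x y assume "x \<in> A \<inter> C" "y \<in> B n"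
        then have "1 / real (n + 1) \<le> infdist y C" "infdist y C \<le> dist y x"
          by (auto simp: B_def infdist_le)
        then have "1 / real (n + 1) \<le> dist x y" by (simp add: dist_commute)
        moreover have "1 / real (n + 1) / 2 < 1 / real (n + 1)" by (simp add: field_simps)
        ultimately show "1 / real (n + 1) / 2 < dist x y" by linarith
      qed
      also have "\<dots> \<le> hausdorff_outer d A"
        by (rule hausdorff_outer_mono) (auto simp: B_def)
      finally have AB: "hausdorff_outer d (A \<inter> C) + hausdorff_outer d (B n) \<le> hausdorff_outer d A" .
      have "hausdorff_outer d (A \<inter> C) + hausdorff_outer d (A - C)
          \<le> hausdorff_outer d (A \<inter> C) + hausdorff_outer d (B n) + ennreal e"
        using AC by (simp add: add.assoc add_left_mono)
      also have "\<dots> \<le> hausdorff_outer d A + ennreal e"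
        using AB by (rule add_right_mono)
      finally show "hausdorff_outer d (A \<inter> C) + hausdorff_outer d (A - C) \<le> hausdorff_outer d A + ennreal e" .
    qed
  qed
  have "hausdorff_outer d (A \<inter> C) + hausdorff_outer d (A - C) = hausdorff_outer d A" for A
  proof (rule antisym)
    show "hausdorff_outer d (A \<inter> C) + hausdorff_outer d (A - C) \<le> hausdorff_outer d A"
      using le[of A] by (cases "C = {}"; cases "hausdorff_outer d A < top")
        (auto simp: less_top[symmetric])
    have "hausdorff_outer d ((A \<inter> C) \<union> (A - C)) \<le> hausdorff_outer d (A \<inter> C) + hausdorff_outer d (A - C)"
      by (rule hausdorff_outer_Un_le)
    then show "hausdorff_outer d A \<le> hausdorff_outer d (A \<inter> C) + hausdorff_outer d (A - C)"
      by (simp add: Int_Diff_Un)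
  qed
  moreover have "(UNIV - C) \<inter> A = A - C" for A by blast
  ultimately show ?thesis
    unfolding lambda_system_def by (simp add: Int_commute)
qed

lemma measure_space_hausdorff_outer:
  "measure_space (UNIV :: 'a::metric_space set) (sets borel) (hausdorff_outer d)"
proof -
  interpret P: sigma_algebra "UNIV :: 'a set" "Pow UNIV" by (rule sigma_algebra_Pow)
  let ?L = "lambda_system (UNIV :: 'a set) (Pow UNIV) (hausdorff_outer d)"
  have L: "measure_space UNIV ?L (hausdorff_outer d)"
    by (rule P.caratheodory_lemma[OF outer_measure_space_hausdorff_outer])
  then interpret L: sigma_algebra UNIV ?L by (simp add: measure_space_def)
  have "sets (borel :: 'a measure) \<subseteq> ?L"
    unfolding borel_eq_closed
    by (subst sets_measure_of, simp, intro L.sigma_sets_subset)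
       (use closed_in_lambda_system_hausdorff_outer in blast)
  then show ?thesis
    using L sets.sigma_algebra_axioms[of "borel :: 'a measure"]
    by (auto simp: measure_space_def positive_def countably_additive_def)
qed

lemma sets_hausdorff_measure [simp, measurable_cong]: "sets (hausdorff_measure d) = sets borel"
  unfolding hausdorff_measure_def
  by (metis sets.sigma_sets_eq sets_measure_of sets.space_closed space_borel)

lemma space_hausdorff_measure [simp]: "space (hausdorff_measure d) = UNIV"
  unfolding hausdorff_measure_def by (simp add: space_measure_of_conv)

lemma emeasure_hausdorff_measure:
  "A \<in> sets borel \<Longrightarrow> emeasure (hausdorff_measure d) A = hausdorff_outer d A"
  using measure_space_hausdorff_outer[of d, where 'a = 'a]
  by (intro emeasure_measure_of[OF hausdorff_measure_def])
     (auto simp: measure_space_def)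


section \<open>Convex bodies and the general dual volume\<close>

definition convex_compacts_origin :: "'a::euclidean_space set set" where
  "convex_compacts_origin = {K. compact K \<and> convex K \<and> 0 \<in> K}"

definition radial_function :: "'a::euclidean_space set \<Rightarrow> 'a \<Rightarrow> real" where
  "radial_function K u = (SUP l \<in> {l. 0 \<le> l \<and> l *\<^sub>R u \<in> K}. l)"

definition support_function :: "'a::euclidean_space set \<Rightarrow> 'a \<Rightarrow> real" where
  "support_function K u = (SUP x \<in> K. u \<bullet> x)"

text \<open>Both suprema are maxima for the sets and directions considered.\<close>

lemma radial_function_max:
  assumes K: "K \<in> convex_compacts_origin" and u: "u \<noteq> 0"
  shows "0 \<le> radial_function K u" "radial_function K u *\<^sub>R u \<in> K"
    and "\<And>l. 0 \<le> l \<Longrightarrow> l *\<^sub>R u \<in> K \<Longrightarrow> l \<le> radial_function K u"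
proof -
  let ?S = "{l. 0 \<le> l \<and> l *\<^sub>R u \<in> K}"
  have cK: "closed K" and bK: "bounded K" and 0: "0 \<in> ?S"
    using K by (auto simp: convex_compacts_origin_def compact_imp_closed compact_imp_bounded)
  obtain b where b: "\<And>x. x \<in> K \<Longrightarrow> norm x \<le> b" using bK by (auto simp: bounded_iff)
  have "l \<le> b / norm u" if "l \<in> ?S" for l
    using b[of "l *\<^sub>R u"] that u by (simp add: field_simps)
  then have bdd: "bdd_above ?S" by (rule bdd_aboveI)
  have "closed ({0..} \<inter> (\<lambda>l. l *\<^sub>R u) -` K)"
    by (intro closed_Int closed_vimage cK continuous_intros closed_atLeast)
  also have "{0..} \<inter> (\<lambda>l. l *\<^sub>R u) -` K = ?S" by auto
  finally have "Sup ?S \<in> ?S"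
    using 0 bdd by (intro closed_contains_Sup) auto
  then show "0 \<le> radial_function K u" "radial_function K u *\<^sub>R u \<in> K"
    by (simp_all add: radial_function_def)
  show "l \<le> radial_function K u" if "0 \<le> l" "l *\<^sub>R u \<in> K" for l
    using that bdd by (auto simp: radial_function_def intro: cSup_upper)
qed

lemma support_function_max:
  assumes "K \<in> convex_compacts_origin"
  shows "\<exists>x\<in>K. support_function K u = u \<bullet> x" and "\<And>x. x \<in> K \<Longrightarrow> u \<bullet> x \<le> support_function K u"
proof -
  have K: "compact K" "K \<noteq> {}" using assms by (auto simp: convex_compacts_origin_def)
  have "\<exists>x\<in>K. \<forall>y\<in>K. u \<bullet> y \<le> u \<bullet> x"
    by (intro continuous_attains_sup K continuous_intros)
  then obtain x where x: "x \<in> K" "\<And>y. y \<in> K \<Longrightarrow> u \<bullet> y \<le> u \<bullet> x" by blast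
  then have "support_function K u = u \<bullet> x"
    unfolding support_function_def by (intro cSup_eq_maximum) auto
  with x show "\<exists>x\<in>K. support_function K u = u \<bullet> x"
    and "\<And>x. x \<in> K \<Longrightarrow> u \<bullet> x \<le> support_function K u" by auto
qed

definition hausdorff_distance :: "'a::euclidean_space set \<Rightarrow> 'a set \<Rightarrow> real" where
  "hausdorff_distance K L = (SUP u \<in> sphere 0 1. \<bar>support_function K u - support_function L u\<bar>)"

text \<open>For \<open>G\<close> as in the theorem the integrand is bounded and Borel on the sphere (the radial
  function is upper semicontinuous), so the Bochner integral has its intended meaning.\<close>

definition general_dual_volume :: "(real \<Rightarrow> 'a \<Rightarrow> real) \<Rightarrow> 'a::euclidean_space set \<Rightarrow> real" where
  "general_dual_volume G K =
     (LINT u:sphere 0 1|hausdorff_measure (DIM('a) - 1). G (radial_function K u) u)"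

end

theory Submission
  imports Defs
begin

text \<open>
  The proof is dominated convergence on the sphere. Hausdorff convergent bodies have uniformly
  bounded radial functions, so continuity of \<open>G\<close> on a compact set \<open>[0, R] \<times> S\<close> bounds all
  integrands by one constant, which is integrable because the sphere has finite
  \<open>(n - 1)\<close>-dimensional Hausdorff measure. It remains to show that the radial functions converge
  almost everywhere.

  Radial functions need not converge everywhere, since the origin may lie on the boundary of \<open>K\<close>.
  Separation by hyperplanes shows that a point outside \<open>K\<close> is eventually outside \<open>K\<^sub>i\<close>, and that a
  point in the interior of \<open>K\<close> is eventually inside \<open>K\<^sub>i\<close>. The first fact always gives
  \<open>limsup \<rho>\<^sub>i \<le> \<rho>\<close>. The second gives \<open>liminf \<rho>\<^sub>i \<ge> \<rho>\<close> in every direction whose ray meets the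
  interior of \<open>K\<close>, and if the ray meets \<open>K\<close> in the origin alone, then \<open>\<rho> = 0\<close> and there is nothing
  to prove. The remaining directions, called grazing below, are those whose ray meets \<open>K\<close> in a
  segment contained in the boundary (\<open>radial_function_tendsto\<close>).

  The cone over the grazing directions is covered by the countably many dilates of the boundary of
  \<open>K\<close>, and the boundary of a convex set is a Lebesgue null set. So both measure theoretic facts,
  finiteness for the sphere and nullity for grazing directions, follow from one comparison of the
  Hausdorff measure of \<open>A \<subseteq> S\<close> with the volume of a neighbourhood of the shell
  \<open>{t u | 1 \<le> t \<le> 2, u \<in> A}\<close> (\<open>hausdorff_outer_sphere_le\<close>). To prove it, cover the shell by small
  balls for which the sum of the \<open>r\<^sub>k ^ n\<close> is at most a constant times that volume. A ball of radius
  \<open>r\<^sub>k\<close> meets the spheres of radius \<open>t\<close> only for \<open>t\<close> in an interval of length \<open>2 r\<^sub>k\<close>. Averaging over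
  \<open>t\<close> therefore yields one radius \<open>t\<close> such that the balls meeting the sphere of radius \<open>t\<close> have a small
  sum of \<open>r\<^sub>k ^ (n - 1)\<close>. Their traces on that sphere, scaled back to radius 1, cover \<open>A\<close>.
\<close>

section \<open>Hausdorff measure of subsets of the sphere\<close>

text \<open>The interval has length 1, so the integral over it is a mean of \<open>F\<close>.\<close>

lemma exists_le_nn_integral_Icc:
  fixes F :: "real \<Rightarrow> ennreal"
  assumes [measurable]: "F \<in> borel_measurable borel"
  shows "\<exists>t\<in>{1..2}. F t \<le> (\<integral>\<^sup>+x. F x \<partial>lborel)"
proof (rule ccontr)
  define B where "B = (\<integral>\<^sup>+x. F x \<partial>lborel)"
  assume "\<not> ?thesis"
  then have less: "B < F t" if "t \<in> {1..2}" for t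
    using that by (auto simp: B_def not_le)
  then have fin: "B \<noteq> \<infinity>"
    by (metis atLeastAtMost_iff infinity_ennreal_def not_top_less one_le_numeral order_refl)
  have "(\<integral>\<^sup>+x. B * indicator {1..2::real} x \<partial>lborel) < (\<integral>\<^sup>+x. F x * indicator {1..2} x \<partial>lborel)"
  proof (rule nn_integral_less)
    show "(\<integral>\<^sup>+x. B * indicator {1..2::real} x \<partial>lborel) \<noteq> \<infinity>"
      using fin by (simp add: nn_integral_cmult_indicator ennreal_mult_eq_top_iff)
    show "AE x in lborel. B * indicator {1..2::real} x \<le> F x * indicator {1..2} x"
      using less by (intro AE_I2) (auto split: split_indicator intro: less_imp_le)
    show "\<not> (AE x in lborel. F x * indicator {1..2} x \<le> B * indicator {1..2::real} x)"
    proof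
      assume "AE x in lborel. F x * indicator {1..2} x \<le> B * indicator {1..2::real} x"
      then have "AE x in lborel. x \<notin> {1..2::real}"
        by eventually_elim (use less in \<open>force split: split_indicator_asm\<close>)
      then have "{1..2::real} \<in> null_sets lborel"
        by (subst AE_iff_null_sets) auto
      then show False by (auto simp: null_sets_def)
    qed
  qed auto
  also have "\<dots> \<le> B"
    unfolding B_def by (intro nn_integral_mono) (auto split: split_indicator)
  finally show False
    by (simp add: nn_integral_cmult_indicator)
qed

lemma cube_subset_cball:
  fixes u v :: "'a::euclidean_space"
  assumes "\<And>i. i \<in> Basis \<Longrightarrow> v \<bullet> i - u \<bullet> i = s"
  shows "cbox u v \<subseteq> cball u (real DIM('a) * s)"
proof
  fix x assume x: "x \<in> cbox u v"
  have "norm (x - u) \<le> (\<Sum>i\<in>Basis. \<bar>(x - u) \<bullet> i\<bar>)" by (rule norm_le_l1)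
  also have "\<dots> \<le> (\<Sum>i\<in>(Basis::'a set). s)"
  proof (rule sum_mono)
    fix i :: 'a assume i: "i \<in> Basis"
    then have "u \<bullet> i \<le> x \<bullet> i" "x \<bullet> i \<le> v \<bullet> i" using x by (auto simp: mem_box)
    then show "\<bar>(x - u) \<bullet> i\<bar> \<le> s" using assms[OF i] by (simp add: inner_diff_left)
  qed
  finally show "x \<in> cball u (real DIM('a) * s)" by (simp add: dist_norm norm_minus_commute)
qed

text \<open>The balls are circumscribed about the cubes of a dyadic covering with disjoint interiors
  inside \<open>U\<close>. The cubes have total volume at most that of \<open>U\<close>, and a cube of side \<open>s\<close> lies in the
  ball of radius \<open>n s\<close> about its corner, which accounts for the factor \<open>n ^ n\<close>.\<close>

lemma small_ball_cover:
  fixes S U :: "'a::euclidean_space set"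
  assumes S: "bounded S" and U: "open U" "S \<subseteq> U" and \<delta>: "\<delta> > 0"
  obtains c :: "nat \<Rightarrow> 'a" and r :: "nat \<Rightarrow> real"
  where "S \<subseteq> (\<Union>k. cball (c k) (r k))" "\<And>k. 0 \<le> r k" "\<And>k. r k \<le> \<delta>"
    "(\<Sum>k. ennreal (r k ^ DIM('a))) \<le> ennreal (real DIM('a) ^ DIM('a)) * emeasure lborel U"
proof -
  define N where "N = DIM('a)"
  have N: "N > 0" by (simp add: N_def)
  obtain b where b: "\<And>x. x \<in> S \<Longrightarrow> norm x \<le> b" and "b > 0"
    using S by (auto simp: bounded_pos)
  define e where "e = \<delta> / (2 * real N)"
  have e: "e > 0" using \<delta> N by (simp add: e_def)
  define g where "g x = (if x \<in> U then U \<inter> ball x e else ball x e)" for x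
  have gauge: "gauge g" using e U by (auto simp: gauge_def g_def)
  have "S \<subseteq> cbox (- (b *\<^sub>R One)) (b *\<^sub>R One)"
  proof
    fix x assume "x \<in> S"
    then have "\<bar>x \<bullet> i\<bar> \<le> b" if "i \<in> Basis" for i
      using b Basis_le_norm[OF that, of x] by force
    then show "x \<in> cbox (- (b *\<^sub>R One)) (b *\<^sub>R One)"
      by (fastforce simp: mem_box abs_le_iff)
  qed
  moreover have "box (- (b *\<^sub>R One)) (b *\<^sub>R One :: 'a) \<noteq> {}"
    using \<open>b > 0\<close> by (simp add: box_ne_empty)
  ultimately obtain \<D> where \<D>: "countable \<D>"
      "\<And>K. K \<in> \<D> \<Longrightarrow> interior K \<noteq> {} \<and> (\<exists>c d. K = cbox c d)"
      "pairwise (\<lambda>A B. interior A \<inter> interior B = {}) \<D>"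
      "\<And>K. K \<in> \<D> \<Longrightarrow> \<exists>x \<in> S \<inter> K. K \<subseteq> g x"
      "\<And>u v. cbox u v \<in> \<D> \<Longrightarrow>
        \<exists>n. \<forall>i\<in>Basis. v \<bullet> i - u \<bullet> i = ((b *\<^sub>R One) \<bullet> i - (- (b *\<^sub>R One)) \<bullet> i) / 2^n"
      "S \<subseteq> \<Union>\<D>"
    by (rule covering_lemma[OF _ _ gauge]) metis
  have cube: "\<exists>u s. Q \<subseteq> cball u (real N * s) \<and> 0 \<le> s \<and> real N * s \<le> \<delta> \<and>
      ennreal (s ^ N) = emeasure lborel (interior Q) \<and> Q \<subseteq> U" if Q: "Q \<in> \<D>" for Q
  proof -
    obtain u v where uv: "Q = cbox u v" using \<D>(2)[OF Q] by blast
    obtain n where n: "\<And>i. i \<in> Basis \<Longrightarrow> v \<bullet> i - u \<bullet> i = 2 * b / 2^n"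
      using \<D>(5) Q uv by fastforce
    define s where "s = 2 * b / 2^n"
    have s: "s > 0" using \<open>b > 0\<close> by (simp add: s_def)
    have side: "v \<bullet> i - u \<bullet> i = s" if "i \<in> Basis" for i using n that by (simp add: s_def)
    have le: "u \<bullet> i \<le> v \<bullet> i" if "i \<in> Basis" for i using side[OF that] s by linarith
    obtain x where x: "x \<in> S" "x \<in> Q" "Q \<subseteq> g x" using \<D>(4)[OF Q] by blast
    then have QU: "Q \<subseteq> U" "Q \<subseteq> ball x e" using U by (auto simp: g_def split: if_splits)
    have "u \<in> Q" "v \<in> Q" using le by (auto simp: uv mem_box)
    then have "dist u v < 2 * e" 
      using QU(2) by (metis dist_triangle_half_l dist_commute mem_ball mult_2 
          field_sum_of_halves subsetD nonzero_mult_div_cancel_left zero_neq_numeral)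
    moreover obtain i :: 'a where i: "i \<in> Basis" by fastforce
    have "s \<le> norm (v - u)"
      using Basis_le_norm[OF i, of "v - u"] side[OF i] s by (simp add: inner_diff_left)
    ultimately have "s < 2 * e" by (simp add: dist_norm norm_minus_commute)
    then have "real N * s \<le> \<delta>" using N by (simp add: e_def field_simps)
    moreover have "emeasure lborel (interior Q) = ennreal (s ^ N)"
      using le side by (simp add: uv interior_cbox inner_diff_left N_def)
    ultimately show ?thesis
      using cube_subset_cball[of v u s] side s QU uv by (metis N_def less_imp_le)
  qed
  then obtain u s where us: "\<And>Q. Q \<in> \<D> \<Longrightarrow> Q \<subseteq> cball (u Q) (real N * s Q)"
      "\<And>Q. Q \<in> \<D> \<Longrightarrow> 0 \<le> s Q" "\<And>Q. Q \<in> \<D> \<Longrightarrow> real N * s Q \<le> \<delta>"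
      "\<And>Q. Q \<in> \<D> \<Longrightarrow> ennreal (s Q ^ N) = emeasure lborel (interior Q)"
      "\<And>Q. Q \<in> \<D> \<Longrightarrow> Q \<subseteq> U"
    by metis
  \<comment> \<open>The covering may be finite, so indices without a cube get radius 0 and the empty set.\<close>
  define I where "I = to_nat_on \<D> ` \<D>"
  define f where "f = from_nat_into \<D>"
  have f: "f k \<in> \<D>" if "k \<in> I" for k using that \<D>(1) by (auto simp: I_def f_def)
  have f_inj: "f j \<noteq> f k" if "j \<in> I" "k \<in> I" "j \<noteq> k" for j k
    using that \<D>(1) by (auto simp: I_def f_def)
  define r where "r k = (if k \<in> I then real N * s (f k) else 0)" for k
  define W where "W k = (if k \<in> I then interior (f k) else {})" for k
  have "S \<subseteq> (\<Union>k. cball (u (f k)) (r k))"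
  proof
    fix x assume "x \<in> S"
    then obtain Q where Q: "Q \<in> \<D>" "x \<in> Q" using \<D>(6) by blast
    then have "to_nat_on \<D> Q \<in> I" "f (to_nat_on \<D> Q) = Q" using \<D>(1) by (auto simp: I_def f_def)
    then have "x \<in> cball (u (f (to_nat_on \<D> Q))) (r (to_nat_on \<D> Q))"
      using us(1)[OF Q(1)] Q(2) by (auto simp: r_def)
    then show "x \<in> (\<Union>k. cball (u (f k)) (r k))" by blast
  qed
  moreover have "0 \<le> r k" "r k \<le> \<delta>" for k using us f \<delta> by (auto simp: r_def)
  moreover have "(\<Sum>k. ennreal (r k ^ N)) \<le> ennreal (real N ^ N) * emeasure lborel U"
  proof -
    have "ennreal (r k ^ N) = ennreal (real N ^ N) * emeasure lborel (W k)" for k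
      using us(2,4)[OF f, of k] N
      by (auto simp: r_def W_def power_mult_distrib ennreal_mult)
    then have "(\<Sum>k. ennreal (r k ^ N)) = ennreal (real N ^ N) * (\<Sum>k. emeasure lborel (W k))"
      by simp
    moreover have "(\<Sum>k. emeasure lborel (W k)) = emeasure lborel (\<Union>k. W k)"
    proof (rule suminf_emeasure)
      show "disjoint_family W"
        using \<D>(3) f f_inj by (auto simp: disjoint_family_on_def W_def pairwise_def)
    qed (auto simp: W_def)
    moreover have "W k \<subseteq> U" for k
      using us(5)[OF f, of k] interior_subset[of "f k"] by (auto simp: W_def)
    then have "emeasure lborel (\<Union>k. W k) \<le> emeasure lborel U"
      using U by (intro emeasure_mono UN_least) auto
    ultimately show ?thesis by (simp add: mult_left_mono)
  qed
  ultimately show ?thesis unfolding N_def by (rule that)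
qed

text \<open>This replaces polar coordinates: volumes of neighbourhoods of the shell over \<open>A\<close> control the
  Hausdorff measure of \<open>A\<close>. The radius at which the covering balls are cut is chosen by averaging,
  and the exponent of the ball radii drops from \<open>n\<close> to \<open>n - 1\<close> because a ball of radius \<open>r\<close>
  contributes only for radii \<open>t\<close> in an interval of length \<open>2 r\<close>.\<close>

theorem hausdorff_outer_sphere_le:
  fixes A U :: "'a::euclidean_space set"
  assumes A: "A \<subseteq> sphere 0 1" and U: "open U"
    and sub: "\<And>t u. 1 \<le> t \<Longrightarrow> t \<le> 2 \<Longrightarrow> u \<in> A \<Longrightarrow> t *\<^sub>R u \<in> U"
  shows "hausdorff_outer (DIM('a) - 1) A
    \<le> ennreal (2 * unit_ball_vol (real (DIM('a) - 1)) * real DIM('a) ^ DIM('a)) * emeasure lborel U"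
proof -
  define d where "d = DIM('a) - 1"
  have d: "DIM('a) = Suc d" using DIM_positive[where 'a='a] by (simp add: d_def)
  define \<omega> where "\<omega> = unit_ball_vol (real d)"
  have \<omega>: "\<omega> \<ge> 0" by (simp add: \<omega>_def)
  let ?N = "real DIM('a) ^ DIM('a)"
  define S where "S = {t *\<^sub>R u | t u. t \<in> {1..2} \<and> u \<in> A}"
  have "norm x \<le> 2" if "x \<in> S" for x
    using that A by (auto simp: S_def subset_iff)
  then have S: "bounded S" "S \<subseteq> U"
    using sub by (auto simp: bounded_iff S_def)
  have "hausdorff_pre d \<delta> A \<le> ennreal (2 * \<omega> * ?N) * emeasure lborel U" if "\<delta> > 0" for \<delta>
  proof -
    obtain c :: "nat \<Rightarrow> 'a" and r where
      cr: "S \<subseteq> (\<Union>k. cball (c k) (r k))" "\<And>k. 0 \<le> r k" "\<And>k. r k \<le> \<delta> / 2"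
        "(\<Sum>k. ennreal (r k ^ DIM('a))) \<le> ennreal ?N * emeasure lborel U"
      using small_ball_cover[OF S(1) U S(2) half_gt_zero[OF \<open>\<delta> > 0\<close>]] by blast
    \<comment> \<open>\<open>J k\<close> contains every \<open>t\<close> whose sphere meets the \<open>k\<close>-th ball, and \<open>F t\<close> bounds the
        contribution of the balls met by the sphere of radius \<open>t\<close>.\<close>
    define J where "J k = {norm (c k) - r k .. norm (c k) + r k}" for k
    define F where "F t = (\<Sum>k. ennreal (r k ^ d) * indicator (J k) t)" for t
    have "(\<integral>\<^sup>+t. F t \<partial>lborel) = (\<Sum>k. \<integral>\<^sup>+t. ennreal (r k ^ d) * indicator (J k) t \<partial>lborel)"
      unfolding F_def by (intro nn_integral_suminf) (simp add: J_def)
    also have "\<dots> = (\<Sum>k. 2 * ennreal (r k ^ Suc d))"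
    proof (intro suminf_cong)
      fix k
      have "(\<integral>\<^sup>+t. ennreal (r k ^ d) * indicator (J k) t \<partial>lborel) = ennreal (r k ^ d) * ennreal (2 * r k)"
        using cr(2)[of k] by (simp add: J_def nn_integral_cmult_indicator)
      also have "\<dots> = 2 * ennreal (r k ^ Suc d)"
        using cr(2)[of k] by (simp add: ennreal_mult mult_ac)
      finally show "(\<integral>\<^sup>+t. ennreal (r k ^ d) * indicator (J k) t \<partial>lborel) = 2 * ennreal (r k ^ Suc d)" .
    qed
    also have "\<dots> = 2 * (\<Sum>k. ennreal (r k ^ Suc d))" by simp
    also have "\<dots> \<le> 2 * (ennreal ?N * emeasure lborel U)"
      using cr(4) by (intro mult_left_mono) (simp_all only: d zero_le)
    finally have int: "(\<integral>\<^sup>+t. F t \<partial>lborel) \<le> 2 * (ennreal ?N * emeasure lborel U)" .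
    have "F \<in> borel_measurable borel" unfolding F_def J_def by measurable
    then obtain t where t: "t \<in> {1..2}" "F t \<le> 2 * (ennreal ?N * emeasure lborel U)"
      using exists_le_nn_integral_Icc int by (meson order_trans)
    \<comment> \<open>Since \<open>t \<ge> 1\<close>, scaling from radius \<open>t\<close> to radius 1 does not increase diameters.\<close>
    define V where "V k = {u \<in> A. t *\<^sub>R u \<in> cball (c k) (r k)}" for k
    have dist_V: "norm (x - y) \<le> 2 * r k" if "x \<in> V k" "y \<in> V k" for x y k
    proof -
      have "norm (x - y) \<le> t * norm (x - y)"
        using t(1) by (simp add: mult_le_cancel_right1)
      also have "\<dots> = dist (t *\<^sub>R x) (t *\<^sub>R y)"
        using t(1) by (simp add: dist_norm flip: scaleR_diff_right)
      also have "\<dots> \<le> dist (c k) (t *\<^sub>R x) + dist (c k) (t *\<^sub>R y)"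
        by (rule dist_triangle3)
      also have "\<dots> \<le> 2 * r k" using that by (simp add: V_def)
      finally show ?thesis .
    qed
    have bounded_V: "bounded (V k)" for k
      using A by (intro bounded_subset[OF bounded_sphere[of "0::'a" 1]]) (auto simp: V_def)
    have diam: "diameter (V k) \<le> 2 * r k" for k
      using dist_V cr(2) by (intro diameter_le) auto
    have weight: "hausdorff_weight d (V k) \<le> ennreal \<omega> * (ennreal (r k ^ d) * indicator (J k) t)" for k
    proof (cases "V k = {}")
      case False
      then obtain x where x: "x \<in> A" "dist (c k) (t *\<^sub>R x) \<le> r k" by (auto simp: V_def)
      have "\<bar>norm (c k) - norm (t *\<^sub>R x)\<bar> \<le> r k"
        using norm_triangle_ineq3[of "c k" "t *\<^sub>R x"] x(2) by (simp add: dist_norm)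
      moreover have "norm (t *\<^sub>R x) = t" using x(1) A t(1) by (auto simp: subset_iff)
      ultimately have "t \<in> J k" by (auto simp: J_def)
      moreover have "ennreal (\<omega> * (diameter (V k) / 2) ^ d) \<le> ennreal (\<omega> * r k ^ d)"
        using diam[of k] diameter_ge_0[OF bounded_V[of k]] \<omega>
        by (intro ennreal_leI mult_left_mono power_mono) auto
      ultimately show ?thesis
        using False \<omega> cr(2)[of k] by (simp add: hausdorff_weight_def \<omega>_def ennreal_mult)
    qed simp
    have "hausdorff_pre d \<delta> A \<le> (\<Sum>k. hausdorff_weight d (V k))"
    proof (rule hausdorff_pre_le)
      show "A \<subseteq> (\<Union>k. V k)"
      proof
        fix x assume "x \<in> A"
        then have "t *\<^sub>R x \<in> S" using t by (auto simp: S_def)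
        then show "x \<in> (\<Union>k. V k)" using cr(1) \<open>x \<in> A\<close> by (force simp: V_def)
      qed
      show "bounded (V k)" for k
        by (rule bounded_V)
      show "diameter (V k) \<le> \<delta>" for k using diam[of k] cr(3)[of k] by simp
    qed
    also have "\<dots> \<le> (\<Sum>k. ennreal \<omega> * (ennreal (r k ^ d) * indicator (J k) t))"
      by (intro suminf_le weight) auto
    also have "\<dots> = ennreal \<omega> * F t" unfolding F_def by simp
    also have "\<dots> \<le> ennreal \<omega> * (2 * (ennreal ?N * emeasure lborel U))"
      by (intro mult_left_mono t) simp
    also have "\<dots> = ennreal (2 * \<omega> * ?N) * emeasure lborel U"
      using \<omega> by (simp add: ennreal_mult mult_ac)
    finally show ?thesis .
  qed
  then show ?thesis
    unfolding hausdorff_outer_def d_def[symmetric] \<omega>_def[symmetric]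
    by (intro SUP_least) auto
qed

corollary hausdorff_measure_sphere_finite:
  "emeasure (hausdorff_measure (DIM('a) - 1)) (sphere (0::'a::euclidean_space) 1) < \<infinity>"
proof -
  let ?C = "ennreal (2 * unit_ball_vol (real (DIM('a) - 1)) * real DIM('a) ^ DIM('a))"
  have "hausdorff_outer (DIM('a) - 1) (sphere (0::'a) 1) \<le> ?C * emeasure lborel (ball (0::'a) 3)"
    by (rule hausdorff_outer_sphere_le) auto
  also have "\<dots> < \<infinity>"
    using emeasure_bounded_finite[OF bounded_ball[of "0::'a" 3]]
    by (simp add: ennreal_mult_less_top)
  finally show ?thesis by (simp add: emeasure_hausdorff_measure)
qed

text \<open>A null set has open neighbourhoods of arbitrarily small volume.\<close>

corollary hausdorff_outer_sphere_eq_0: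
  fixes A :: "'a::euclidean_space set"
  assumes A: "A \<subseteq> sphere 0 1" and D: "negligible D"
    and sub: "\<And>t u. 1 \<le> t \<Longrightarrow> t \<le> 2 \<Longrightarrow> u \<in> A \<Longrightarrow> t *\<^sub>R u \<in> D"
  shows "hausdorff_outer (DIM('a) - 1) A = 0"
proof -
  define C where "C = 2 * unit_ball_vol (real (DIM('a) - 1)) * real DIM('a) ^ DIM('a)"
  have C: "C > 0" by (simp add: C_def)
  have "hausdorff_outer (DIM('a) - 1) A \<le> 0"
  proof (rule ennreal_le_epsilon)
    fix e :: real assume e: "e > 0"
    obtain T where T: "open T" "D \<subseteq> T" "emeasure lebesgue (T - D) < ennreal (e / C)"
      using sets_lebesgue_outer_open[OF negligible_imp_sets[OF D] divide_pos_pos[OF e C]] by metis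
    have "emeasure lborel T = emeasure lebesgue (T - D \<union> D)"
      using T by (simp add: Un_absorb2 emeasure_completion)
    also have "\<dots> = emeasure lebesgue (T - D)"
      using T D by (intro emeasure_Un_null_set) (auto simp: negligible_iff_null_sets)
    finally have "emeasure lborel T \<le> ennreal (e / C)" using T(3) by simp
    moreover have "hausdorff_outer (DIM('a) - 1) A \<le> ennreal C * emeasure lborel T"
      unfolding C_def using A T sub by (intro hausdorff_outer_sphere_le) blast+
    ultimately have "hausdorff_outer (DIM('a) - 1) A \<le> ennreal C * ennreal (e / C)"
      by (meson mult_left_mono order_trans zero_le)
    also have "\<dots> = ennreal e" using C e by (simp flip: ennreal_mult)
    finally show "hausdorff_outer (DIM('a) - 1) A \<le> 0 + ennreal e" by simp
  qed
  then show ?thesis by simp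
qed

section \<open>Directions in which a convex body is seen only through its boundary\<close>

text \<open>The radial function can fail to converge only here: approximating bodies can avoid a
  segment that \<open>K\<close> has on its boundary.\<close>

definition grazing_directions :: "'a::euclidean_space set \<Rightarrow> 'a set" where
  "grazing_directions K =
     {u \<in> sphere 0 1. (\<exists>l>0. l *\<^sub>R u \<in> K) \<and> (\<forall>l>0. l *\<^sub>R u \<notin> interior K)}"

lemma convex_compacts_origin_scale_down:
  assumes "K \<in> convex_compacts_origin" "l *\<^sub>R u \<in> K" "0 \<le> s" "s \<le> l"
  shows "s *\<^sub>R u \<in> K"
proof (cases "l = 0")
  case False
  then have "(s / l) *\<^sub>R (l *\<^sub>R u) + (1 - s / l) *\<^sub>R 0 \<in> K"
    using assms by (intro convexD) (auto simp: convex_compacts_origin_def)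
  then show ?thesis using False by simp
qed (use assms in auto)

text \<open>Restricting to countably many scales makes the set of grazing directions visibly Borel.\<close>

lemma exists_scale_iff_inverse_nat:
  assumes K: "K \<in> convex_compacts_origin"
  shows "(\<exists>l>0. l *\<^sub>R u \<in> K) \<longleftrightarrow> (\<exists>n. inverse (real (Suc n)) *\<^sub>R u \<in> K)"
proof
  assume "\<exists>l>0. l *\<^sub>R u \<in> K"
  then obtain l where l: "l > 0" "l *\<^sub>R u \<in> K" by blast
  then obtain n where "inverse (real (Suc n)) < l" using reals_Archimedean by blast
  then show "\<exists>n. inverse (real (Suc n)) *\<^sub>R u \<in> K"
    using convex_compacts_origin_scale_down[OF K l(2)] by (intro exI[of _ n]) simp
next
  assume "\<exists>n. inverse (real (Suc n)) *\<^sub>R u \<in> K"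
  then obtain n where "inverse (real (Suc n)) *\<^sub>R u \<in> K" ..
  then show "\<exists>l>0. l *\<^sub>R u \<in> K" by (intro exI[of _ "inverse (real (Suc n))"]) simp
qed

lemma borel_grazing_directions:
  fixes K :: "'a::euclidean_space set"
  assumes K: "K \<in> convex_compacts_origin"
  shows "grazing_directions K \<in> sets borel"
proof -
  have "closed K" using K by (simp add: convex_compacts_origin_def compact_imp_closed)
  then have "closed {u::'a. a *\<^sub>R u \<in> K}" for a
    using closed_vimage[of K "\<lambda>u. a *\<^sub>R u"] by (simp add: vimage_def continuous_intros)
  then have 1: "(\<Union>n. {u::'a. inverse (real (Suc n)) *\<^sub>R u \<in> K}) \<in> sets borel"
    by (intro sets.countable_UN) auto
  have "open {u::'a. a *\<^sub>R u \<in> interior K}" for a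
    using open_vimage[of "interior K" "\<lambda>u. a *\<^sub>R u"] by (simp add: vimage_def continuous_intros)
  then have 2: "(\<Union>l\<in>{0<..}. {u::'a. l *\<^sub>R u \<in> interior K}) \<in> sets borel"
    by (intro borel_open open_UN) auto
  have "grazing_directions K = sphere 0 1 \<inter> (\<Union>n. {u. inverse (real (Suc n)) *\<^sub>R u \<in> K})
      - (\<Union>l\<in>{0<..}. {u. l *\<^sub>R u \<in> interior K})"
    unfolding grazing_directions_def exists_scale_iff_inverse_nat[OF K] by auto
  also have "\<dots> \<in> sets borel"
    using 1 2 by (intro sets.Diff sets.Int) auto
  finally show ?thesis .
qed

text \<open>If \<open>l u \<in> K\<close> and \<open>m \<ge> t / l\<close>, then \<open>(t / m) u\<close> lies in \<open>K\<close> because \<open>K\<close> is star-shaped about the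
  origin, but for a grazing direction \<open>u\<close> it is not an interior point. Hence \<open>t u\<close> lies in the
  \<open>m\<close>-fold dilate of the boundary of \<open>K\<close>, which is a null set.\<close>

theorem grazing_directions_null:
  fixes K :: "'a::euclidean_space set"
  assumes K: "K \<in> convex_compacts_origin"
  shows "grazing_directions K \<in> null_sets (hausdorff_measure (DIM('a) - 1))"
proof -
  define D where "D = (\<Union>m. (\<lambda>x. real m *\<^sub>R x) ` frontier K)"
  have "negligible (frontier K)"
    using K by (intro negligible_convex_frontier) (simp add: convex_compacts_origin_def)
  then have D: "negligible D"
    unfolding D_def
    by (intro negligible_Union_nat negligible_differentiable_image_negligible
        linear_imp_differentiable_on linear_scaleR order_refl)
  have "hausdorff_outer (DIM('a) - 1) (grazing_directions K) = 0"
  proof (rule hausdorff_outer_sphere_eq_0[OF _ D])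
    show "grazing_directions K \<subseteq> sphere 0 1" by (auto simp: grazing_directions_def)
    fix t :: real and u assume t: "1 \<le> t" "t \<le> 2" and u: "u \<in> grazing_directions K"
    then obtain l where l: "l > 0" "l *\<^sub>R u \<in> K" by (auto simp: grazing_directions_def)
    obtain m where m: "t / l \<le> real m" using real_arch_simple by blast
    then have m0: "real m > 0" using t l by (smt (verit) divide_pos_pos)
    then have "t / real m \<le> l" using m l by (simp add: field_simps)
    then have "(t / real m) *\<^sub>R u \<in> K"
      using convex_compacts_origin_scale_down[OF K l(2)] t m0 by simp
    moreover have "(t / real m) *\<^sub>R u \<notin> interior K"
      using u t m0 by (simp add: grazing_directions_def)
    ultimately have "(t / real m) *\<^sub>R u \<in> frontier K"
      using closure_subset by (auto simp: frontier_def)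
    moreover have "t *\<^sub>R u = real m *\<^sub>R ((t / real m) *\<^sub>R u)" using m0 by simp
    ultimately show "t *\<^sub>R u \<in> D" unfolding D_def by blast
  qed
  then show ?thesis
    using borel_grazing_directions[OF K] by (intro null_setsI) (auto simp: emeasure_hausdorff_measure)
qed

section \<open>Hausdorff convergence of convex bodies\<close>

lemma support_function_bounded:
  fixes K :: "'a::euclidean_space set"
  assumes K: "K \<in> convex_compacts_origin"
  obtains b where "\<And>u. norm u = 1 \<Longrightarrow> \<bar>support_function K u\<bar> \<le> b"
proof -
  have "bounded K" using K by (simp add: convex_compacts_origin_def compact_imp_bounded)
  then obtain b where b: "\<And>x. x \<in> K \<Longrightarrow> norm x \<le> b" unfolding bounded_iff by blast
  have "\<bar>support_function K u\<bar> \<le> b" if "norm u = 1" for u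
  proof -
    obtain x where x: "x \<in> K" "support_function K u = u \<bullet> x"
      using support_function_max(1)[OF K] by blast
    have "\<bar>u \<bullet> x\<bar> \<le> norm x" using Cauchy_Schwarz_ineq2[of u x] that by simp
    then show ?thesis using b[OF x(1)] x(2) by linarith
  qed
  then show ?thesis by (rule that)
qed

lemma support_function_diff_le:
  fixes K L :: "'a::euclidean_space set"
  assumes K: "K \<in> convex_compacts_origin" and L: "L \<in> convex_compacts_origin"
    and u: "norm u = 1"
  shows "\<bar>support_function K u - support_function L u\<bar> \<le> hausdorff_distance K L"
proof -
  obtain a b where ab: "\<And>u. norm u = 1 \<Longrightarrow> \<bar>support_function K u\<bar> \<le> a"
      "\<And>u. norm u = 1 \<Longrightarrow> \<bar>support_function L u\<bar> \<le> b"
    using support_function_bounded[OF K] support_function_bounded[OF L] by metis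
  have "\<bar>support_function K u - support_function L u\<bar> \<le> a + b" if "norm u = 1" for u
    using ab(1)[OF that] ab(2)[OF that] by linarith
  then have "bdd_above ((\<lambda>u. \<bar>support_function K u - support_function L u\<bar>) ` sphere 0 1)"
    by (intro bdd_aboveI2[of _ _ "a + b"]) simp
  then show ?thesis
    unfolding hausdorff_distance_def using u by (intro cSUP_upper) auto
qed

lemma separating_unit_vector:
  fixes K :: "'a::euclidean_space set"
  assumes K: "K \<in> convex_compacts_origin" and x: "x \<notin> K"
  obtains a where "norm a = 1" "support_function K a < a \<bullet> x"
proof -
  have cK: "closed K" "convex K" "0 \<in> K"
    using K by (auto simp: convex_compacts_origin_def compact_imp_closed)
  obtain a b where ab: "a \<bullet> x < b" "\<And>y. y \<in> K \<Longrightarrow> b < a \<bullet> y"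
    using separating_hyperplane_closed_point[OF cK(2,1) x] by blast
  have a0: "a \<noteq> 0" using ab(1) ab(2)[OF cK(3)] by auto
  define c where "c = - (a /\<^sub>R norm a)"
  obtain y where y: "y \<in> K" "support_function K c = c \<bullet> y"
    using support_function_max(1)[OF K] by blast
  have "a \<bullet> x < a \<bullet> y" using ab y(1) by force
  then have "c \<bullet> y < c \<bullet> x" using a0 by (simp add: c_def divide_simps)
  then show ?thesis using y(2) a0 by (intro that[of c]) (auto simp: c_def)
qed

context
  fixes K :: "'a::euclidean_space set" and Ki :: "nat \<Rightarrow> 'a set"
  assumes Ki: "\<And>i. Ki i \<in> convex_compacts_origin" and K: "K \<in> convex_compacts_origin"
    and lim: "(\<lambda>i. hausdorff_distance (Ki i) K) \<longlonglongrightarrow> 0"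
begin

text \<open>A hyperplane that strictly separates the point from \<open>K\<close> still separates it from bodies whose
  support functions are close enough to that of \<open>K\<close>.\<close>

lemma hausdorff_limit_eventually_not_mem:
  assumes "x \<notin> K"
  shows "\<forall>\<^sub>F i in sequentially. x \<notin> Ki i"
proof -
  obtain a where a: "norm a = 1" "support_function K a < a \<bullet> x"
    using separating_unit_vector[OF K assms] .
  have "\<forall>\<^sub>F i in sequentially. hausdorff_distance (Ki i) K < a \<bullet> x - support_function K a"
    using a(2) by (intro order_tendstoD(2)[OF lim]) simp
  then show ?thesis
  proof eventually_elim
    case (elim i)
    then show ?case
      using support_function_diff_le[OF Ki K a(1), of i] support_function_max(2)[OF Ki, of x i a]
      by fastforce
  qed
qed

text \<open>If \<open>x\<close> is missing from \<open>K\<^sub>i\<close>, then for some unit vector \<open>a\<close> the support function of \<open>K\<^sub>i\<close> at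
  \<open>a\<close> is below \<open>a \<bullet> x\<close>, while that of \<open>K\<close> is at least \<open>a \<bullet> x + r\<close> when the ball of radius \<open>r\<close>
  about \<open>x\<close> lies in \<open>K\<close>. So the two bodies are at Hausdorff distance at least \<open>r\<close>.\<close>

lemma hausdorff_limit_eventually_mem:
  assumes "x \<in> interior K"
  shows "\<forall>\<^sub>F i in sequentially. x \<in> Ki i"
proof -
  obtain r where r: "r > 0" "cball x r \<subseteq> K" using assms by (auto simp: mem_interior_cball)
  have "\<forall>\<^sub>F i in sequentially. hausdorff_distance (Ki i) K < r"
    using r(1) by (intro order_tendstoD(2)[OF lim])
  then show ?thesis
  proof eventually_elim
    case (elim i)
    show ?case
    proof (rule ccontr)
      assume "x \<notin> Ki i"
      then obtain a where a: "norm a = 1" "support_function (Ki i) a < a \<bullet> x"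
        using separating_unit_vector[OF Ki] by blast
      have "x + r *\<^sub>R a \<in> K" using r a(1) by (intro subsetD[OF r(2)]) (simp add: dist_norm)
      then have "a \<bullet> (x + r *\<^sub>R a) \<le> support_function K a" by (rule support_function_max(2)[OF K])
      moreover have "a \<bullet> (x + r *\<^sub>R a) = a \<bullet> x + r"
        using a(1) by (simp add: inner_add_right power2_norm_eq_inner[symmetric])
      ultimately show False
        using support_function_diff_le[OF Ki K a(1), of i] a(2) elim by linarith
    qed
  qed
qed

text \<open>For the lower bound, a single interior point of \<open>K\<close> on the ray suffices: by convexity the
  points of the ray strictly between it and the boundary point \<open>\<rho>(u) u\<close> are again interior.\<close>

theorem radial_function_tendsto:
  assumes u: "u \<in> sphere 0 1" and ng: "u \<notin> grazing_directions K"
  shows "(\<lambda>i. radial_function (Ki i) u) \<longlonglongrightarrow> radial_function K u"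
proof (rule order_tendstoI)
  have u0: "u \<noteq> 0" using u by auto
  note \<rho> = radial_function_max[OF K u0] and \<rho>i = radial_function_max[OF Ki u0]
  fix a
  {
    assume a: "radial_function K u < a"
    define l where "l = (radial_function K u + a) / 2"
    have l: "radial_function K u < l" "l < a" "0 \<le> l" using a \<rho>(1) by (auto simp: l_def)
    then have "l *\<^sub>R u \<notin> K" using \<rho>(3) by force
    then have "\<forall>\<^sub>F i in sequentially. l *\<^sub>R u \<notin> Ki i" by (rule hausdorff_limit_eventually_not_mem)
    then show "\<forall>\<^sub>F i in sequentially. radial_function (Ki i) u < a"
    proof eventually_elim
      case (elim i)
      then have "\<not> l \<le> radial_function (Ki i) u"
        using convex_compacts_origin_scale_down[OF Ki \<rho>i(2) l(3)] by blast
      then show ?case using l by simp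
    qed
  next
    assume a: "a < radial_function K u"
    show "\<forall>\<^sub>F i in sequentially. a < radial_function (Ki i) u"
    proof (cases "a < 0")
      case True
      then show ?thesis using \<rho>i(1) by (intro always_eventually allI) (rule less_le_trans)
    next
      case False
      then have "\<exists>l>0. l *\<^sub>R u \<in> K" using a \<rho>(2) by (intro exI[of _ "radial_function K u"]) auto
      then obtain l0 where l0: "l0 > 0" "l0 *\<^sub>R u \<in> interior K"
        using ng u by (auto simp: grazing_directions_def)
      define \<rho>0 where "\<rho>0 = radial_function K u"
      have l0\<rho>: "l0 \<le> \<rho>0" using l0 \<rho>(3) interior_subset unfolding \<rho>0_def by force
      \<comment> \<open>\<open>e\<close> is the fraction of the way from \<open>\<rho>0\<close> down to \<open>l0\<close>, small enough to stay above \<open>a\<close>.\<close>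
      define e where "e = min 1 ((\<rho>0 - a) / (2 * \<rho>0))"
      have pos: "\<rho>0 > 0" using l0\<rho> l0 by simp
      have e: "0 < e" "e \<le> 1" "e * \<rho>0 \<le> (\<rho>0 - a) / 2"
        using a pos unfolding e_def \<rho>0_def[symmetric]
        by (auto simp: min_def field_simps)
      define l where "l = \<rho>0 - e * (\<rho>0 - l0)"
      have "e * (\<rho>0 - l0) \<le> e * \<rho>0" using e l0 by (intro mult_left_mono) auto
      then have la: "a < l" using e(3) a by (simp add: l_def \<rho>0_def[symmetric])
      have "\<rho>0 *\<^sub>R u - e *\<^sub>R (\<rho>0 *\<^sub>R u - l0 *\<^sub>R u) \<in> interior K"
        using K l0(2) \<rho>(2) e
        by (intro mem_interior_convex_shrink) (auto simp: convex_compacts_origin_def \<rho>0_def)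
      then have "l *\<^sub>R u \<in> interior K" by (simp add: l_def algebra_simps)
      then have "\<forall>\<^sub>F i in sequentially. l *\<^sub>R u \<in> Ki i" by (rule hausdorff_limit_eventually_mem)
      then show ?thesis
      proof eventually_elim
        case (elim i)
        then show ?case using \<rho>i(3)[of l i] la False by force
      qed
    qed
  }
qed

text \<open>In a unit direction the radial function is at most the support function, and the support
  functions of the \<open>K\<^sub>i\<close> stay within a bounded distance of that of \<open>K\<close>.\<close>

lemma radial_function_uniformly_bounded:
  obtains R where "\<And>u. u \<in> sphere 0 1 \<Longrightarrow> radial_function K u \<le> R"
    "\<And>i u. u \<in> sphere 0 1 \<Longrightarrow> radial_function (Ki i) u \<le> R"
proof -
  obtain b where b: "\<And>u. norm u = 1 \<Longrightarrow> \<bar>support_function K u\<bar> \<le> b"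
    using support_function_bounded[OF K] by metis
  obtain B where B: "B > 0" "\<And>i. norm (hausdorff_distance (Ki i) K) \<le> B"
    using convergent_imp_Bseq[OF convergentI[OF lim]] by (auto elim: BseqE)
  have le: "radial_function M u \<le> support_function M u"
    if "M \<in> convex_compacts_origin" "u \<in> sphere 0 1" for M :: "'a set" and u
  proof -
    have "u \<bullet> (radial_function M u *\<^sub>R u) \<le> support_function M u"
      using that by (intro support_function_max(2) radial_function_max(2)) auto
    then show ?thesis using that(2) by (simp add: power2_norm_eq_inner[symmetric])
  qed
  have sb: "support_function K u \<le> b" if "u \<in> sphere 0 1" for u
    using b[of u] that by simp
  show ?thesis
  proof (rule that[of "b + B"])
    fix u :: 'a assume u: "u \<in> sphere 0 1"
    show "radial_function K u \<le> b + B" using le[OF K u] sb[OF u] B(1) by linarith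
    fix i
    show "radial_function (Ki i) u \<le> b + B"
      using le[OF Ki u, of i] sb[OF u] B(2)[of i] support_function_diff_le[OF Ki K, of u i] u
      by (simp add: abs_le_iff)
  qed
qed

end

section \<open>Continuity of the general dual volume\<close>

text \<open>The radial function is upper semicontinuous: since \<open>K\<close> is star-shaped about the origin,
  the direction \<open>u\<close> satisfies \<open>\<rho>(u) \<ge> a\<close> for \<open>a \<ge> 0\<close> exactly when \<open>a u \<in> K\<close>, a closed condition.\<close>

lemma radial_function_measurable:
  fixes K :: "'a::euclidean_space set"
  assumes K: "K \<in> convex_compacts_origin"
  shows "radial_function K \<in> borel_measurable (restrict_space borel (sphere 0 1))"
  unfolding borel_measurable_iff_ge
proof
  fix a :: real
  have cK: "closed K" using K by (simp add: convex_compacts_origin_def compact_imp_closed)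
  have "{u \<in> space (restrict_space borel (sphere (0::'a) 1)). a \<le> radial_function K u}
      = {u. max 0 a *\<^sub>R u \<in> K} \<inter> sphere 0 1"
  proof -
    have "a \<le> radial_function K u \<longleftrightarrow> max 0 a *\<^sub>R u \<in> K" if "u \<in> sphere 0 1" for u
    proof -
      have "u \<noteq> 0" using that by auto
      note \<rho> = radial_function_max[OF K this]
      show ?thesis
        using \<rho>(1) \<rho>(3)[of "max 0 a"] convex_compacts_origin_scale_down[OF K \<rho>(2), of "max 0 a"] by auto
    qed
    then show ?thesis by (auto simp: space_restrict_space)
  qed
  moreover have "closed {u::'a. max 0 a *\<^sub>R u \<in> K}"
    using closed_vimage[OF cK, of "\<lambda>u. max 0 a *\<^sub>R u"] by (simp add: vimage_def continuous_intros)
  ultimately show "{u \<in> space (restrict_space borel (sphere 0 1)). a \<le> radial_function K u}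
      \<in> sets (restrict_space borel (sphere 0 1))"
    using sets_restrict_space_iff[of "sphere (0::'a) 1" borel]
    by (simp add: borel_closed sets.Int)
qed

lemma dual_volume_integrand_measurable:
  fixes K :: "'a::euclidean_space set" and G :: "real \<Rightarrow> 'a \<Rightarrow> real"
  assumes K: "K \<in> convex_compacts_origin"
    and G: "continuous_on ({0..} \<times> sphere 0 1) (\<lambda>(t, u). G t u)"
  shows "(\<lambda>u. indicator (sphere 0 1) u *\<^sub>R G (radial_function K u) u) \<in> borel_measurable borel"
proof -
  let ?S = "restrict_space borel (sphere (0::'a) 1)"
  have "(\<lambda>u. u) \<in> measurable ?S borel" by (intro measurable_restrict_space1) simp
  then have "(\<lambda>u. (radial_function K u, u)) \<in> measurable ?S borel"
    using radial_function_measurable[OF K] by (rule borel_measurable_Pair[rotated])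
  moreover have "0 \<le> radial_function K u" if "u \<in> sphere 0 1" for u
    using that by (intro radial_function_max(1)[OF K]) auto
  ultimately have "(\<lambda>u. (radial_function K u, u)) \<in>
      measurable ?S (restrict_space borel ({0..} \<times> sphere 0 1))"
    by (intro measurable_restrict_space2) (auto simp: space_restrict_space)
  from measurable_compose[OF this borel_measurable_continuous_on_restrict[OF G]]
  show ?thesis by (subst (asm) borel_measurable_restrict_space_iff) auto
qed

theorem general_dual_volume_tendsto:
  fixes G :: "real \<Rightarrow> 'a::euclidean_space \<Rightarrow> real"
  assumes G: "continuous_on ({0..} \<times> sphere 0 1) (\<lambda>(t, u). G t u)"
    and Ki: "\<And>i. Ki i \<in> convex_compacts_origin" and K: "K \<in> convex_compacts_origin"
    and lim: "(\<lambda>i. hausdorff_distance (Ki i) K) \<longlonglongrightarrow> 0"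
  shows "(\<lambda>i. general_dual_volume G (Ki i)) \<longlonglongrightarrow> general_dual_volume G K"
proof -
  let ?M = "hausdorff_measure (DIM('a) - 1) :: 'a measure"
  let ?S = "sphere (0::'a) 1"
  obtain R where R: "\<And>u. u \<in> ?S \<Longrightarrow> radial_function K u \<le> R"
      "\<And>i u. u \<in> ?S \<Longrightarrow> radial_function (Ki i) u \<le> R"
    using radial_function_uniformly_bounded[OF Ki K lim] by blast
  have "compact ((\<lambda>(t, u). G t u) ` ({0..R} \<times> ?S))"
    by (intro compact_continuous_image continuous_on_subset[OF G] compact_Times) auto
  then obtain B where B: "\<And>t u. 0 \<le> t \<Longrightarrow> t \<le> R \<Longrightarrow> u \<in> ?S \<Longrightarrow> \<bar>G t u\<bar> \<le> B"
    by (force dest!: compact_imp_bounded simp: bounded_iff)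
  have \<rho>0: "0 \<le> radial_function L u" if "L \<in> convex_compacts_origin" "u \<in> ?S" for L u
    using that by (intro radial_function_max(1)) auto
  show ?thesis
    unfolding general_dual_volume_def set_lebesgue_integral_def
  proof (rule integral_dominated_convergence)
    show "(\<lambda>u. indicator ?S u *\<^sub>R G (radial_function K u) u) \<in> borel_measurable ?M"
      using dual_volume_integrand_measurable[OF K G] by (simp cong: measurable_cong_sets)
    show "(\<lambda>u. indicator ?S u *\<^sub>R G (radial_function (Ki i) u) u) \<in> borel_measurable ?M" for i
      using dual_volume_integrand_measurable[OF Ki G] by (simp cong: measurable_cong_sets)
    show "integrable ?M (\<lambda>u. indicator ?S u *\<^sub>R B)"
      using hausdorff_measure_sphere_finite[where 'a='a]
      by (intro integrable_scaleR_left integrable_real_indicator) auto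
    show "AE u in ?M. norm (indicator ?S u *\<^sub>R G (radial_function (Ki i) u) u) \<le> indicator ?S u *\<^sub>R B" for i
      using B R \<rho>0[OF Ki] by (intro AE_I2) (auto split: split_indicator)
    show "AE u in ?M. (\<lambda>i. indicator ?S u *\<^sub>R G (radial_function (Ki i) u) u)
        \<longlonglongrightarrow> indicator ?S u *\<^sub>R G (radial_function K u) u"
    proof (rule AE_mp[OF AE_not_in[OF grazing_directions_null[OF K]]], intro AE_I2 impI)
      fix u assume ng: "u \<notin> grazing_directions K"
      show "(\<lambda>i. indicator ?S u *\<^sub>R G (radial_function (Ki i) u) u)
        \<longlonglongrightarrow> indicator ?S u *\<^sub>R G (radial_function K u) u"
      proof (cases "u \<in> ?S")
        case u: True
        have "(\<lambda>i. (radial_function (Ki i) u, u)) \<longlonglongrightarrow> (radial_function K u, u)"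
          using radial_function_tendsto[OF Ki K lim u ng] by (intro tendsto_Pair) auto
        from continuous_on_tendsto_compose[OF G this] show ?thesis
          using u \<rho>0[OF Ki u] \<rho>0[OF K u] by simp
      qed simp
    qed
  qed
qed

theorem lemma3p2:
  fixes G :: "real \<Rightarrow> real ^ 'n \<Rightarrow> real"
    and K :: "(real ^ 'n) set"
    and Ki :: "nat \<Rightarrow> (real ^ 'n) set"
  assumes "2 \<le> CARD('n)"
    and "continuous_on ({0..} \<times> sphere 0 1) (\<lambda>(t, u). G t u)"
    and "\<And>t u. 0 \<le> t \<Longrightarrow> u \<in> sphere 0 1 \<Longrightarrow> 0 \<le> G t u"
    and "\<And>i. Ki i \<in> convex_compacts_origin"
    and "K \<in> convex_compacts_origin"
    and "(\<lambda>i. hausdorff_distance (Ki i) K) \<longlonglongrightarrow> 0"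
  shows "(\<lambda>i. general_dual_volume G (Ki i)) \<longlonglongrightarrow> general_dual_volume G K"
  using assms(2,4-6) by (rule general_dual_volume_tendsto)

end
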